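(* Let $\lambda_1,\lambda_2,\lambda_3>0$ and let $\mathbb{K}$ be the associated algebra of 3-parameter generalized quaternions. Let $p\in\mathbb{K}$ with $N_p=1$ be written in polar form as $p=\cos\frac{\theta}{2}+\hat p\,\sin\frac{\theta}{2}$, where $\theta\in\mathbb{R}$ and $\hat p=s_1e_1+s_2e_2+s_3e_3$ satisfies $\lambda_1\lambda_2s_1^2+\lambda_1\lambda_3s_2^2+\lambda_2\lambda_3s_3^2=1$. Let $\mathcal{A}dp$ be the matrix with respect to the basis $\{e_1,e_2,e_3\}$ of the linear map $\mathrm{Im}(\mathbb{K})\to\mathrm{Im}(\mathbb{K})$, $q\mapsto pqp^{-1}$, and let $$S=\begin{bmatrix}0&-\lambda_3s_3&\lambda_3s_2\\\lambda_2s_3&0&-\lambda_2s_1\\-\lambda_1s_2&\lambda_1s_1&0\end{bmatrix}.$$ Then $$\mathcal{A}dp=I+\sin\theta\,S+(1-\cos\theta)\,S^2,$$ where $I$ is the $3\times3$ identity matrix.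
   Context: Given $\lambda_1,\lambda_2,\lambda_3\in\mathbb{R}$, $\mathbb{K}$ is the (associative, unital) real algebra with vector-space basis $1,e_1,e_2,e_3$, unit $1$, and bilinear multiplication determined by $e_1^2=-\lambda_1\lambda_2$, $e_2^2=-\lambda_1\lambda_3$, $e_3^2=-\lambda_2\lambda_3$, $e_1e_2=\lambda_1e_3=-e_2e_1$, $e_2e_3=\lambda_3e_1=-e_3e_2$, $e_3e_1=\lambda_2e_2=-e_1e_3$. For $p=a_0+a_1e_1+a_2e_2+a_3e_3\in\mathbb{K}$ (with $a_i\in\mathbb{R}$), the conjugate is $\bar p=a_0-a_1e_1-a_2e_2-a_3e_3$, the norm is $N_p=p\bar p=a_0^2+\lambda_1\lambda_2a_1^2+\lambda_1\lambda_3a_2^2+\lambda_2\lambda_3a_3^2$, and $p^{-1}=\bar p$ when $N_p=1$. $\mathrm{Im}(\mathbb{K})=\{a_1e_1+a_2e_2+a_3e_3:a_i\in\mathbb{R}\}$. *)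

theory Defs
  imports "HOL-Analysis.Analysis"
begin

text \<open>The underlying vector space does not depend on the three parameters, so one type of
  coordinate quadruples serves all of them; the parameters enter through the multiplication.\<close>

datatype gquat = GQuat (gq0: real) (gq1: real) (gq2: real) (gq3: real)

lemma gquat_eq_iff:
  "p = q \<longleftrightarrow> gq0 p = gq0 q \<and> gq1 p = gq1 q \<and> gq2 p = gq2 q \<and> gq3 p = gq3 q"
  by (auto intro: gquat.expand)

instantiation gquat :: real_vector
begin

definition "0 = GQuat 0 0 0 0"
definition "p + q = GQuat (gq0 p + gq0 q) (gq1 p + gq1 q) (gq2 p + gq2 q) (gq3 p + gq3 q)"
definition "- p = GQuat (- gq0 p) (- gq1 p) (- gq2 p) (- gq3 p)"
definition "p - q = GQuat (gq0 p - gq0 q) (gq1 p - gq1 q) (gq2 p - gq2 q) (gq3 p - gq3 q)"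
definition "c *\<^sub>R p = GQuat (c * gq0 p) (c * gq1 p) (c * gq2 p) (c * gq3 p)"

instance
  by standard
    (auto simp: gquat_eq_iff zero_gquat_def plus_gquat_def uminus_gquat_def minus_gquat_def
       scaleR_gquat_def algebra_simps)

end

lemmas gquat_vector_defs = zero_gquat_def plus_gquat_def uminus_gquat_def minus_gquat_def
  scaleR_gquat_def

definition gq_one :: gquat where "gq_one = GQuat 1 0 0 0"
definition gq_e1 :: gquat where "gq_e1 = GQuat 0 1 0 0"
definition gq_e2 :: gquat where "gq_e2 = GQuat 0 0 1 0"
definition gq_e3 :: gquat where "gq_e3 = GQuat 0 0 0 1"

lemmas gquat_basis_defs = gq_one_def gq_e1_def gq_e2_def gq_e3_def

lemma gquat_basis_expansion:
  "p = a0 *\<^sub>R gq_one + a1 *\<^sub>R gq_e1 + a2 *\<^sub>R gq_e2 + a3 *\<^sub>R gq_e3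
     \<longleftrightarrow> a0 = gq0 p \<and> a1 = gq1 p \<and> a2 = gq2 p \<and> a3 = gq3 p"
  by (auto simp: gquat_eq_iff gquat_basis_defs gquat_vector_defs)

text \<open>The bilinear extension of the multiplication table that is proved in \<open>gq_mult_table\<close>.\<close>

definition gq_mult :: "real \<Rightarrow> real \<Rightarrow> real \<Rightarrow> gquat \<Rightarrow> gquat \<Rightarrow> gquat" where
  "gq_mult l1 l2 l3 p q = GQuat
     (gq0 p * gq0 q - l1 * l2 * gq1 p * gq1 q - l1 * l3 * gq2 p * gq2 q - l2 * l3 * gq3 p * gq3 q)
     (gq0 p * gq1 q + gq1 p * gq0 q + l3 * (gq2 p * gq3 q - gq3 p * gq2 q))
     (gq0 p * gq2 q + gq2 p * gq0 q + l2 * (gq3 p * gq1 q - gq1 p * gq3 q))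
     (gq0 p * gq3 q + gq3 p * gq0 q + l1 * (gq1 p * gq2 q - gq2 p * gq1 q))"

lemma gq_mult_table:
  "gq_mult l1 l2 l3 gq_e1 gq_e1 = (- (l1 * l2)) *\<^sub>R gq_one"
  "gq_mult l1 l2 l3 gq_e2 gq_e2 = (- (l1 * l3)) *\<^sub>R gq_one"
  "gq_mult l1 l2 l3 gq_e3 gq_e3 = (- (l2 * l3)) *\<^sub>R gq_one"
  "gq_mult l1 l2 l3 gq_e1 gq_e2 = l1 *\<^sub>R gq_e3"
  "gq_mult l1 l2 l3 gq_e2 gq_e1 = - (l1 *\<^sub>R gq_e3)"
  "gq_mult l1 l2 l3 gq_e2 gq_e3 = l3 *\<^sub>R gq_e1"
  "gq_mult l1 l2 l3 gq_e3 gq_e2 = - (l3 *\<^sub>R gq_e1)"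
  "gq_mult l1 l2 l3 gq_e3 gq_e1 = l2 *\<^sub>R gq_e2"
  "gq_mult l1 l2 l3 gq_e1 gq_e3 = - (l2 *\<^sub>R gq_e2)"
  by (simp_all add: gq_mult_def gquat_eq_iff gquat_basis_defs gquat_vector_defs)

lemma gq_mult_unit: "gq_mult l1 l2 l3 gq_one p = p" "gq_mult l1 l2 l3 p gq_one = p"
  by (simp_all add: gq_mult_def gquat_eq_iff gq_one_def)

lemma gq_mult_bilinear:
  "linear (gq_mult l1 l2 l3 p)" "linear (\<lambda>p. gq_mult l1 l2 l3 p q)"
  by (auto intro!: linearI simp: gq_mult_def gquat_eq_iff gquat_vector_defs algebra_simps)

lemma gq_mult_assoc:
  "gq_mult l1 l2 l3 (gq_mult l1 l2 l3 p q) r = gq_mult l1 l2 l3 p (gq_mult l1 l2 l3 q r)"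
  by (simp add: gq_mult_def gquat_eq_iff algebra_simps)

definition gq_cnj :: "gquat \<Rightarrow> gquat" where
  "gq_cnj p = GQuat (gq0 p) (- gq1 p) (- gq2 p) (- gq3 p)"

definition gq_norm :: "real \<Rightarrow> real \<Rightarrow> real \<Rightarrow> gquat \<Rightarrow> real" where
  "gq_norm l1 l2 l3 p =
     (gq0 p)\<^sup>2 + l1 * l2 * (gq1 p)\<^sup>2 + l1 * l3 * (gq2 p)\<^sup>2 + l2 * l3 * (gq3 p)\<^sup>2"

lemma gq_mult_cnj:
  "gq_mult l1 l2 l3 p (gq_cnj p) = gq_norm l1 l2 l3 p *\<^sub>R gq_one"
  "gq_mult l1 l2 l3 (gq_cnj p) p = gq_norm l1 l2 l3 p *\<^sub>R gq_one"
  by (simp_all add: gq_mult_def gq_cnj_def gq_norm_def gquat_eq_iff gq_one_def scaleR_gquat_def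
       power2_eq_square)

definition gq_inverse :: "real \<Rightarrow> real \<Rightarrow> real \<Rightarrow> gquat \<Rightarrow> gquat" where
  "gq_inverse l1 l2 l3 p = (1 / gq_norm l1 l2 l3 p) *\<^sub>R gq_cnj p"

lemma gq_inverse_norm_one: "gq_norm l1 l2 l3 p = 1 \<Longrightarrow> gq_inverse l1 l2 l3 p = gq_cnj p"
  by (simp add: gq_inverse_def)

lemma gq_inverse:
  assumes "gq_norm l1 l2 l3 p \<noteq> 0"
  shows "gq_mult l1 l2 l3 p (gq_inverse l1 l2 l3 p) = gq_one"
    and "gq_mult l1 l2 l3 (gq_inverse l1 l2 l3 p) p = gq_one"
  using assms
  by (simp_all add: gq_inverse_def linear_scale[OF gq_mult_bilinear(1)]
       linear_scale[OF gq_mult_bilinear(2)] gq_mult_cnj)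

definition gq_Im :: "gquat set" where
  "gq_Im = {a1 *\<^sub>R gq_e1 + a2 *\<^sub>R gq_e2 + a3 *\<^sub>R gq_e3 | a1 a2 a3. True}"

definition gq_of_coords :: "real^3 \<Rightarrow> gquat" where
  "gq_of_coords v = v$1 *\<^sub>R gq_e1 + v$2 *\<^sub>R gq_e2 + v$3 *\<^sub>R gq_e3"

definition gq_coords :: "gquat \<Rightarrow> real^3" where
  "gq_coords q = vector [gq1 q, gq2 q, gq3 q]"

lemma gq_Im_iff: "q \<in> gq_Im \<longleftrightarrow> gq0 q = 0"
proof
  assume "gq0 q = 0"
  then have "q = gq1 q *\<^sub>R gq_e1 + gq2 q *\<^sub>R gq_e2 + gq3 q *\<^sub>R gq_e3"
    by (simp add: gquat_eq_iff gquat_basis_defs gquat_vector_defs)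
  then show "q \<in> gq_Im"
    unfolding gq_Im_def by blast
qed (auto simp: gq_Im_def gquat_basis_defs gquat_vector_defs)

lemma gq_of_coords: "gq_of_coords v \<in> gq_Im" "gq_coords (gq_of_coords v) = v"
  by (simp_all add: gq_Im_iff gq_of_coords_def gq_coords_def gquat_basis_defs gquat_vector_defs
       vec_eq_iff forall_3)

lemma gq_coords: "q \<in> gq_Im \<Longrightarrow> gq_of_coords (gq_coords q) = q"
  by (simp add: gq_Im_iff gq_of_coords_def gq_coords_def gquat_basis_defs gquat_vector_defs
       gquat_eq_iff)

definition gq_Ad :: "real \<Rightarrow> real \<Rightarrow> real \<Rightarrow> gquat \<Rightarrow> gquat \<Rightarrow> gquat" where
  "gq_Ad l1 l2 l3 p q = gq_mult l1 l2 l3 (gq_mult l1 l2 l3 p q) (gq_inverse l1 l2 l3 p)"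

lemma gq_Ad_linear: "linear (gq_Ad l1 l2 l3 p)"
  using linear_compose[OF gq_mult_bilinear(1)[of l1 l2 l3 p]
      gq_mult_bilinear(2)[of l1 l2 l3 "gq_inverse l1 l2 l3 p"]]
  unfolding gq_Ad_def o_def .

text \<open>By the following lemma, \<open>gq_coords\<close> discards only a zero in \<open>gq_Ad_matrix\<close>.\<close>

lemma gq_Ad_Im: "q \<in> gq_Im \<Longrightarrow> gq_Ad l1 l2 l3 p q \<in> gq_Im"
  by (simp add: gq_Im_iff gq_Ad_def gq_inverse_def linear_scale[OF gq_mult_bilinear(1)])
    (simp add: gq_mult_def gq_cnj_def scaleR_gquat_def algebra_simps)

definition gq_Ad_matrix :: "real \<Rightarrow> real \<Rightarrow> real \<Rightarrow> gquat \<Rightarrow> real^3^3" where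
  "gq_Ad_matrix l1 l2 l3 p = matrix (\<lambda>v. gq_coords (gq_Ad l1 l2 l3 p (gq_of_coords v)))"

end

theory Submission
  imports Defs
begin

text \<open>
  Write \<open>u\<close> for the unit axis of \<open>p\<close>, so that \<open>u u = - 1\<close>, and let \<open>L\<close> and \<open>R\<close> be the left and
  right multiplications by \<open>u\<close>. The proof rests on two observations.

  First, \<open>S\<close> is the coordinate matrix of \<open>D = (L - R) / 2\<close>: half a commutator of imaginary
  quaternions is a weighted cross product (\<open>half_commutator_of_coords\<close>).

  Second, associativity makes \<open>L\<close> and \<open>R\<close> commute, and \<open>L L = R R = - 1\<close>, so
  \<open>D D = (- 2 - 2 L R) / 4\<close>, that is, \<open>L R = - 1 - 2 D D\<close>. The inverse of
  \<open>p = c + s u\<close> is \<open>c - s u\<close>, hence conjugation by \<open>p\<close> is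
  \<open>(c + s L) (c - s R) = c\<^sup>2 + c s (L - R) - s\<^sup>2 L R = (c\<^sup>2 + s\<^sup>2) + 2 c s D + 2 s\<^sup>2 D D\<close>,
  where \<open>c\<close> and \<open>s\<close> are the cosine and the sine of \<open>\<theta> / 2\<close>. The double-angle formulas turn the
  coefficients into \<open>1\<close>, \<open>sin \<theta>\<close> and \<open>1 - cos \<theta>\<close> (\<open>gq_mult_conjugation_rodrigues\<close>).
\<close>

definition gq_half_commutator :: "real \<Rightarrow> real \<Rightarrow> real \<Rightarrow> gquat \<Rightarrow> gquat \<Rightarrow> gquat" where
  "gq_half_commutator l1 l2 l3 u q = (1 / 2) *\<^sub>R (gq_mult l1 l2 l3 u q - gq_mult l1 l2 l3 q u)"

lemmas gq_mult_linear_simps =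
  linear_add[OF gq_mult_bilinear(1)] linear_add[OF gq_mult_bilinear(2)]
  linear_diff[OF gq_mult_bilinear(1)] linear_diff[OF gq_mult_bilinear(2)]
  linear_neg[OF gq_mult_bilinear(1)] linear_neg[OF gq_mult_bilinear(2)]
  linear_scale[OF gq_mult_bilinear(1)] linear_scale[OF gq_mult_bilinear(2)]

text \<open>The square of \<open>(L - R) / 2\<close> is \<open>(L L - 2 L R + R R) / 4\<close>, in which \<open>L L\<close> and \<open>R R\<close> are
  both \<open>- 1\<close>; solving for \<open>L R\<close> gives the two-sided product.\<close>

lemma gq_mult_two_sided:
  assumes "gq_mult l1 l2 l3 u u = - gq_one"
  shows "gq_mult l1 l2 l3 (gq_mult l1 l2 l3 u q) u =
    - q - 2 *\<^sub>R gq_half_commutator l1 l2 l3 u (gq_half_commutator l1 l2 l3 u q)"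
proof -
  let ?m = "gq_mult l1 l2 l3"
  have left: "?m u (?m u q) = - q"
    by (simp add: gq_mult_assoc[symmetric] assms gq_mult_linear_simps gq_mult_unit)
  have right: "?m (?m q u) u = - q"
    by (simp add: gq_mult_assoc assms gq_mult_linear_simps gq_mult_unit)
  have "gq_half_commutator l1 l2 l3 u (gq_half_commutator l1 l2 l3 u q) =
      (1 / 4) *\<^sub>R (?m u (?m u q) - 2 *\<^sub>R ?m (?m u q) u + ?m (?m q u) u)"
    by (simp add: gq_half_commutator_def gq_mult_linear_simps gq_mult_assoc
        scaleR_right_diff_distrib scaleR_right_distrib scaleR_2)
  then show ?thesis
    by (simp add: left right gquat_eq_iff gquat_vector_defs)
qed

text \<open>This is Rodrigues' formula before any choice of coordinates. It holds on the whole algebra: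
  \<open>D\<close> kills the scalars, which conjugation fixes.\<close>

lemma gq_mult_conjugation_rodrigues:
  assumes "gq_mult l1 l2 l3 u u = - gq_one"
  shows "gq_mult l1 l2 l3
      (gq_mult l1 l2 l3 (cos (\<theta> / 2) *\<^sub>R gq_one + sin (\<theta> / 2) *\<^sub>R u) q)
      (cos (\<theta> / 2) *\<^sub>R gq_one - sin (\<theta> / 2) *\<^sub>R u) =
    q + sin \<theta> *\<^sub>R gq_half_commutator l1 l2 l3 u q
      + (1 - cos \<theta>) *\<^sub>R
          gq_half_commutator l1 l2 l3 u (gq_half_commutator l1 l2 l3 u q)"
proof -
  define c s where "c = cos (\<theta> / 2)" and "s = sin (\<theta> / 2)"
  let ?m = "gq_mult l1 l2 l3" and ?D = "gq_half_commutator l1 l2 l3 u"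
  have pythagoras: "c * c + s * s = 1"
    unfolding c_def s_def by (metis power2_eq_square sin_cos_squared_add2)
  have sin: "sin \<theta> = 2 * s * c" and cos: "1 - cos \<theta> = 2 * s * s"
    using sin_double[of "\<theta> / 2"] cos_double_sin[of "\<theta> / 2"]
    by (simp_all add: c_def s_def power2_eq_square)
  have "?m (?m (c *\<^sub>R gq_one + s *\<^sub>R u) q) (c *\<^sub>R gq_one - s *\<^sub>R u) =
      (c * c) *\<^sub>R q + (c * s) *\<^sub>R (?m u q - ?m q u) - (s * s) *\<^sub>R ?m (?m u q) u"
    by (simp add: gq_mult_linear_simps gq_mult_unit algebra_simps)
  also have "?m u q - ?m q u = 2 *\<^sub>R ?D q"
    by (simp add: gq_half_commutator_def)
  also have "(c * c) *\<^sub>R q + (c * s) *\<^sub>R (2 *\<^sub>R ?D q) - (s * s) *\<^sub>R ?m (?m u q) u =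
      (c * c + s * s) *\<^sub>R q + (2 * s * c) *\<^sub>R ?D q + (2 * s * s) *\<^sub>R ?D (?D q)"
    by (simp add: gq_mult_two_sided[OF assms] algebra_simps)
  finally show ?thesis
    by (simp add: pythagoras sin cos c_def[symmetric] s_def[symmetric])
qed

text \<open>The scalar parts of \<open>u q\<close> and \<open>q u\<close> agree and cancel, while their vector parts are opposite;
  what remains is the weighted cross product with \<open>u\<close>.\<close>

lemma half_commutator_of_coords:
  assumes "S = vector [vector [0, - l3 * s3, l3 * s2],
                       vector [l2 * s3, 0, - l2 * s1],
                       vector [- l1 * s2, l1 * s1, 0]]"
  shows "gq_half_commutator l1 l2 l3 (s1 *\<^sub>R gq_e1 + s2 *\<^sub>R gq_e2 + s3 *\<^sub>R gq_e3) (gq_of_coords v) =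
    gq_of_coords (S *v v)"
  by (simp add: assms gq_half_commutator_def gq_of_coords_def gq_mult_def gquat_basis_defs
      gquat_vector_defs gquat_eq_iff matrix_vector_mult_def sum_3 algebra_simps)

lemma linear_gq_of_coords: "linear gq_of_coords"
  by (auto intro!: linearI simp: gq_of_coords_def algebra_simps)

theorem theorem5p5:
  fixes l1 l2 l3 \<theta> s1 s2 s3 :: real
    and p p_hat :: gquat
    and S :: "real^3^3"
  assumes "l1 > 0" and "l2 > 0" and "l3 > 0"
    and "gq_norm l1 l2 l3 p = 1"
    and "p_hat = s1 *\<^sub>R gq_e1 + s2 *\<^sub>R gq_e2 + s3 *\<^sub>R gq_e3"
    and "l1 * l2 * s1\<^sup>2 + l1 * l3 * s2\<^sup>2 + l2 * l3 * s3\<^sup>2 = 1"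
    and "p = cos (\<theta> / 2) *\<^sub>R gq_one + sin (\<theta> / 2) *\<^sub>R p_hat"
    and "S = vector [vector [0, - l3 * s3, l3 * s2],
                     vector [l2 * s3, 0, - l2 * s1],
                     vector [- l1 * s2, l1 * s1, 0]]"
  shows "gq_Ad_matrix l1 l2 l3 p = mat 1 + sin \<theta> *\<^sub>R S + (1 - cos \<theta>) *\<^sub>R (S ** S)"
proof -
  let ?D = "gq_half_commutator l1 l2 l3 p_hat"
  let ?A = "mat 1 + sin \<theta> *\<^sub>R S + (1 - cos \<theta>) *\<^sub>R (S ** S)"
  note p_hat = assms(5) and p = assms(7)
  \<comment> \<open>The normalization of the axis says exactly that \<open>p_hat\<close> is a square root of \<open>- 1\<close>.\<close>
  have square: "gq_mult l1 l2 l3 p_hat p_hat = - gq_one"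
    using assms(6)
    by (simp add: p_hat gq_mult_def gquat_basis_defs gquat_vector_defs gquat_eq_iff
        power2_eq_square algebra_simps)
  have inverse: "gq_inverse l1 l2 l3 p = cos (\<theta> / 2) *\<^sub>R gq_one - sin (\<theta> / 2) *\<^sub>R p_hat"
    unfolding gq_inverse_norm_one[OF assms(4)]
    by (simp add: p p_hat gq_cnj_def gquat_basis_defs gquat_vector_defs)
  have D: "?D (gq_of_coords v) = gq_of_coords (S *v v)" for v
    unfolding p_hat by (rule half_commutator_of_coords[OF assms(8)])
  have "gq_Ad l1 l2 l3 p (gq_of_coords v) = gq_of_coords (?A *v v)" for v
  proof -
    have "gq_Ad l1 l2 l3 p (gq_of_coords v) =
        gq_of_coords v + sin \<theta> *\<^sub>R ?D (gq_of_coords v)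
          + (1 - cos \<theta>) *\<^sub>R ?D (?D (gq_of_coords v))"
      unfolding gq_Ad_def inverse unfolding p by (rule gq_mult_conjugation_rodrigues[OF square])
    also have "\<dots> = gq_of_coords (v + sin \<theta> *\<^sub>R (S *v v) + (1 - cos \<theta>) *\<^sub>R (S *v (S *v v)))"
      by (simp add: D linear_add[OF linear_gq_of_coords] linear_scale[OF linear_gq_of_coords])
    also have "\<dots> = gq_of_coords (?A *v v)"
      by (simp add: matrix_vector_mult_add_rdistrib scaleR_matrix_vector_assoc
          matrix_vector_mul_assoc)
    finally show ?thesis .
  qed
  then have "gq_Ad_matrix l1 l2 l3 p = matrix (\<lambda>v. ?A *v v)"
    by (simp add: gq_Ad_matrix_def gq_of_coords(2))
  also have "\<dots> = ?A"
    by (rule matrix_of_matrix_vector_mul)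
  finally show ?thesis .
qed

end
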